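(* Let $p>3$ be a prime with $p\equiv 2\pmod 3$, $q=p^k$, and let $E_1,E_2$ be elliptic curves defined over $\mathbb{F}_q$ with $j(E_1)=j(E_2)=0$. Then $\#E_1(\mathbb{F}_q)=\#E_2(\mathbb{F}_q)$ if and only if $E_1(\mathbb{F}_q)\cong E_2(\mathbb{F}_q)$ as groups.
   Context: For $E:y^2=x^3+Ax+B$ the $j$-invariant is $j(E)=1728\cdot\frac{4A^3}{4A^3+27B^2}$; $j(E)=0$ means $E$ has the form $y^2=x^3+B$. $E(\mathbb{F}_q)$ denotes the group of $\mathbb{F}_q$-rational points. *)

theory Defs
  imports "HOL-Algebra.Group" "HOL-Computational_Algebra.Primes" "HOL-Library.Cardinality"
begin

text \<open>
  The short Weierstrass equation y^2 = x^3 + A x + B over a field of characteristic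
  different from 2 and 3; every elliptic curve over such a field has an equation of this form.
  It is nonsingular exactly when its discriminant -16 (4 A^3 + 27 B^2) is nonzero.
\<close>

definition elliptic_curve :: "'a::field \<Rightarrow> 'a \<Rightarrow> bool" where
  "elliptic_curve A B \<longleftrightarrow> 4 * A ^ 3 + 27 * B ^ 2 \<noteq> 0"

definition j_invariant :: "'a::field \<Rightarrow> 'a \<Rightarrow> 'a" where
  "j_invariant A B = 1728 * (4 * A ^ 3 / (4 * A ^ 3 + 27 * B ^ 2))"

datatype 'a ec_point = EC_Infinity | EC_Affine 'a 'a

definition ec_points :: "'a::field \<Rightarrow> 'a \<Rightarrow> 'a ec_point set" where
  "ec_points A B =
     insert EC_Infinity {EC_Affine x y | x y. y ^ 2 = x ^ 3 + A * x + B}"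

text \<open>
  The chord-and-tangent law. In the last equation \<open>m\<close> is the slope of the chord through the
  two points, or of the tangent when they coincide: two points of the curve with the same
  x-coordinate are equal or opposite, so once opposite points are excluded \<open>x1 = x2\<close> forces
  \<open>y1 = y2\<close> and \<open>y1 \<noteq> 0\<close>. The law does not mention \<open>B\<close>; it is only meaningful on \<open>ec_points A B\<close>.
\<close>

fun ec_add :: "'a::field \<Rightarrow> 'a ec_point \<Rightarrow> 'a ec_point \<Rightarrow> 'a ec_point" where
  "ec_add A EC_Infinity Q = Q"
| "ec_add A (EC_Affine x1 y1) EC_Infinity = EC_Affine x1 y1"
| "ec_add A (EC_Affine x1 y1) (EC_Affine x2 y2) =
     (if x1 = x2 \<and> y1 = - y2 then EC_Infinity
      else let m = (if x1 = x2 then (3 * x1 ^ 2 + A) / (2 * y1) else (y2 - y1) / (x2 - x1));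
               x3 = m ^ 2 - x1 - x2
           in EC_Affine x3 (m * (x1 - x3) - y1))"

definition ec_group :: "'a::field \<Rightarrow> 'a \<Rightarrow> 'a ec_point monoid" where
  "ec_group A B = \<lparr>carrier = ec_points A B, monoid.mult = ec_add A, one = EC_Infinity\<rparr>"

end

theory Submission
  imports Defs "HOL-Algebra.Multiplicative_Group" "HOL-Number_Theory.Residues"
begin

text \<open>
  The condition on \<open>j\<close> means \<open>A = 0\<close>, so the curves are \<open>E\<^sub>B: y\<^sup>2 = x\<^sup>3 + B\<close>, and the group of
  \<open>E\<^sub>B\<close> depends only on \<open>B\<close> modulo sixth powers. Write \<open>B = g\<^sup>i\<close> for a generator \<open>g\<close> of the
  multiplicative group.

  If \<open>k\<close> is odd, cubing is bijective, all \<open>E\<^sub>B\<close> have \<open>q + 1\<close> points and \<open>-27\<close> is not a square.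
  For nonsquare \<open>B\<close> the 3-isogeny from \<open>E\<^sub>B\<close> to \<open>E\<close> with parameter \<open>-27 B\<close> has no rational
  point of order 3 in its kernel, so it is an isomorphism on rational points, and the two classes
  modulo squares give isomorphic groups.

  If \<open>k\<close> is even, let \<open>c(i)\<close> be the number of affine points for \<open>B = g\<^sup>i\<close>, with \<open>i\<close> modulo 6.
  The field automorphism \<open>x \<mapsto> x\<^sup>p\<close> identifies the groups for \<open>i\<close> and \<open>-i\<close>, because \<open>p\<close> is 5 modulo
  6. Counting over the values of \<open>y\<close> gives \<open>c(i) + c(i + 2) + c(i + 4) = 3 q\<close>, and \<open>c(i)\<close> is 2 or 0
  modulo 3 according to the parity of \<open>i\<close>. So \<open>c(0) = c(2) = c(4)\<close> and \<open>c(1) = c(3) = c(5)\<close> are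
  both impossible, as they would force \<open>c(i) = q\<close>, which is 1 modulo 3: the count determines \<open>i\<close>
  up to sign.
\<close>

section \<open>Isomorphisms between groups of points\<close>

lemma ec_group_simps [simp]:
  "carrier (ec_group A B) = ec_points A B"
  "x \<otimes>\<^bsub>ec_group A B\<^esub> y = ec_add A x y"
  by (simp_all add: ec_group_def)

lemma EC_Infinity_in_points [simp]: "EC_Infinity \<in> ec_points A B"
  by (simp add: ec_points_def)

lemma EC_Affine_in_points_iff [simp]:
  "EC_Affine x y \<in> ec_points A B \<longleftrightarrow> y ^ 2 = x ^ 3 + A * x + B"
  by (simp add: ec_points_def)

text \<open>The curve equations and the slope equation are solved for \<open>A\<close> and
  \<open>B\<close> (for a chord also for \<open>y2\<close>). After substitution, the equation for
  the sum is a polynomial identity in the remaining variables.\<close>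

lemma ec_add_closed:
  fixes A B :: "'a::field"
  assumes "(2::'a) \<noteq> 0" "P \<in> ec_points A B" "Q \<in> ec_points A B"
  shows "ec_add A P Q \<in> ec_points A B"
proof (cases P)
  case EC_Infinity
  with assms show ?thesis by simp
next
  case P: (EC_Affine x1 y1)
  show ?thesis
  proof (cases Q)
    case EC_Infinity
    with assms P show ?thesis by simp
  next
    case Q: (EC_Affine x2 y2)
    have e1: "y1 ^ 2 = x1 ^ 3 + A * x1 + B" and e2: "y2 ^ 2 = x2 ^ 3 + A * x2 + B"
      using assms P Q by simp_all
    show ?thesis
    proof (cases "x1 = x2")
      case True
      hence "(y1 - y2) * (y1 + y2) = 0"
        using e1 e2 by (simp add: algebra_simps power2_eq_square)
      hence y: "y1 = y2 \<or> y1 = - y2"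
        by (auto simp: add_eq_0_iff2)
      show ?thesis
      proof (cases "y1 = - y2")
        case True
        with \<open>x1 = x2\<close> P Q show ?thesis by simp
      next
        case False
        hence y12: "y2 = y1" and "y1 \<noteq> 0" using y by auto
        define m where "m = (3 * x1 ^ 2 + A) / (2 * y1)"
        have m: "2 * y1 * m = 3 * x1 ^ 2 + A"
          using \<open>y1 \<noteq> 0\<close> assms(1) by (simp add: m_def)
        have "(m * (x1 - (m ^ 2 - 2 * x1)) - y1) ^ 2
              = (m ^ 2 - 2 * x1) ^ 3 + A * (m ^ 2 - 2 * x1) + B"
        proof -
          have A: "A = 2 * y1 * m - 3 * x1 ^ 2"
            using m by simp
          have B: "B = y1 ^ 2 - x1 ^ 3 - (2 * y1 * m - 3 * x1 ^ 2) * x1"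
            using e1 A by simp
          show ?thesis
            unfolding B unfolding A by (simp add: field_simps eval_nat_numeral)
        qed
        thus ?thesis
          using P Q \<open>x1 = x2\<close> y12 False by (simp add: m_def Let_def algebra_simps)
      qed
    next
      case False
      define m where "m = (y2 - y1) / (x2 - x1)"
      have m: "m * (x2 - x1) = y2 - y1"
        using False by (simp add: m_def)
      \<comment> \<open>The two curve equations are subtracted and \<open>y2 - y1\<close> is written
        as \<open>m * (x2 - x1)\<close>, so that the factor \<open>x2 - x1\<close> can be
        cancelled.\<close>
      have "(x2 - x1) * (x1 ^ 2 + x1 * x2 + x2 ^ 2 + A - m * (y1 + y2)) = 0"
      proof -
        have "(x2 - x1) * (x1 ^ 2 + x1 * x2 + x2 ^ 2 + A - m * (y1 + y2))
            = (x2 ^ 3 + A * x2 + B) - (x1 ^ 3 + A * x1 + B) - m * (x2 - x1) * (y1 + y2)"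
          by (simp add: algebra_simps eval_nat_numeral)
        also have "\<dots> = 0"
          unfolding m e1[symmetric] e2[symmetric] by (simp add: algebra_simps power2_eq_square)
        finally show ?thesis .
      qed
      hence "x1 ^ 2 + x1 * x2 + x2 ^ 2 + A = m * (y1 + y2)"
        using False by simp
      hence A: "A = m * (y1 + y2) - x1 ^ 2 - x1 * x2 - x2 ^ 2"
        by (simp add: algebra_simps)
      have y2: "y2 = y1 + m * (x2 - x1)"
        using m by simp
      have B: "B = y1 ^ 2 - x1 ^ 3 - A * x1"
        using e1 by simp
      have "(m * (x1 - (m ^ 2 - x1 - x2)) - y1) ^ 2
            = (m ^ 2 - x1 - x2) ^ 3 + A * (m ^ 2 - x1 - x2) + B"
        unfolding B unfolding A unfolding y2 by (simp add: algebra_simps eval_nat_numeral)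
      thus ?thesis
        using P Q False by (simp add: m_def Let_def)
    qed
  qed
qed

lemma is_isoI_bij:
  assumes "bij_betw f (carrier G) (carrier H)"
    and "\<And>x y. x \<in> carrier G \<Longrightarrow> y \<in> carrier G \<Longrightarrow> f (x \<otimes>\<^bsub>G\<^esub> y) = f x \<otimes>\<^bsub>H\<^esub> f y"
  shows "G \<cong> H"
  using assms by (intro is_isoI[of f]) (auto simp: iso_def hom_def bij_betw_def)

text \<open>Associativity of \<open>ec_add\<close> is never needed: inverting an isomorphism only uses closure.\<close>

lemma ec_group_iso_sym:
  fixes A B A' B' :: "'a::field"
  assumes "(2::'a) \<noteq> 0" "ec_group A B \<cong> ec_group A' B'"
  shows "ec_group A' B' \<cong> ec_group A B"
proof -
  obtain f where bij: "bij_betw f (ec_points A B) (ec_points A' B')"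
    and hom: "\<And>P Q. P \<in> ec_points A B \<Longrightarrow> Q \<in> ec_points A B \<Longrightarrow>
      f (ec_add A P Q) = ec_add A' (f P) (f Q)"
    using assms(2) by (auto simp: is_iso_def iso_def hom_def)
  let ?g = "inv_into (ec_points A B) f"
  have g: "bij_betw ?g (ec_points A' B') (ec_points A B)"
    using bij by (rule bij_betw_inv_into)
  show ?thesis
  proof (rule is_isoI_bij[of ?g]; simp)
    show "bij_betw ?g (ec_points A' B') (ec_points A B)" by (rule g)
    fix P Q assume PQ: "P \<in> ec_points A' B'" "Q \<in> ec_points A' B'"
    have gPQ: "?g P \<in> ec_points A B" "?g Q \<in> ec_points A B"
      using g PQ by (auto simp: bij_betw_def)
    have "f (ec_add A (?g P) (?g Q)) = ec_add A' P Q"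
      using hom[OF gPQ] PQ bij_betw_inv_into_right[OF bij] by simp
    thus "?g (ec_add A' P Q) = ec_add A (?g P) (?g Q)"
      using bij_betw_inv_into_left[OF bij ec_add_closed[OF assms(1) gPQ]] by simp
  qed
qed

section \<open>Isomorphisms from scaling the coordinates and from field automorphisms\<close>

fun ec_map :: "('a \<Rightarrow> 'a) \<Rightarrow> ('a \<Rightarrow> 'a) \<Rightarrow> 'a ec_point \<Rightarrow> 'a ec_point" where
  "ec_map f g EC_Infinity = EC_Infinity"
| "ec_map f g (EC_Affine x y) = EC_Affine (f x) (g y)"

text \<open>The substitution \<open>(u^2 x, u^3 y)\<close> multiplies every term of the equation by
  \<open>u^6\<close> and every slope by \<open>u\<close>.\<close>

lemma ec_group_iso_scale:
  fixes A B u :: "'a::field"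
  assumes "(2::'a) \<noteq> 0" "u \<noteq> 0"
  shows "ec_group A B \<cong> ec_group (A * u ^ 4) (B * u ^ 6)"
proof (rule is_isoI_bij[of "ec_map (\<lambda>x. u ^ 2 * x) (\<lambda>y. u ^ 3 * y)"]; simp)
  let ?f = "ec_map (\<lambda>x. u ^ 2 * x) (\<lambda>y. u ^ 3 * y)"
  let ?h = "ec_map (\<lambda>x. x / u ^ 2) (\<lambda>y. y / u ^ 3)"
  have on_curve: "(u ^ 3 * y) ^ 2 = (u ^ 2 * x) ^ 3 + A * u ^ 4 * (u ^ 2 * x) + B * u ^ 6 \<longleftrightarrow>
      y ^ 2 = x ^ 3 + A * x + B" for x y
  proof -
    have "(u ^ 3 * y) ^ 2 - ((u ^ 2 * x) ^ 3 + A * u ^ 4 * (u ^ 2 * x) + B * u ^ 6)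
        = u ^ 6 * (y ^ 2 - (x ^ 3 + A * x + B))"
      by (simp add: algebra_simps power_mult_distrib flip: power_mult power_add)
    thus ?thesis using assms(2)
      by (metis eq_iff_diff_eq_0 mult_eq_0_iff power_not_zero)
  qed
  show "bij_betw ?f (ec_points A B) (ec_points (A * u ^ 4) (B * u ^ 6))"
  proof (rule bij_betwI[of _ _ _ ?h])
    show "?f \<in> ec_points A B \<rightarrow> ec_points (A * u ^ 4) (B * u ^ 6)"
    proof
      fix P assume "P \<in> ec_points A B"
      thus "?f P \<in> ec_points (A * u ^ 4) (B * u ^ 6)"
        by (cases P) (simp_all add: on_curve)
    qed
    show "?h \<in> ec_points (A * u ^ 4) (B * u ^ 6) \<rightarrow> ec_points A B"
    proof
      fix P assume P: "P \<in> ec_points (A * u ^ 4) (B * u ^ 6)"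
      show "?h P \<in> ec_points A B"
      proof (cases P)
        case (EC_Affine x y)
        thus ?thesis
          using P on_curve[of "y / u ^ 3" "x / u ^ 2"] assms(2) by simp
      qed simp
    qed
    show "?h (?f P) = P" for P
      using assms(2) by (cases P) auto
    show "?f (?h P) = P" for P
      using assms(2) by (cases P) auto
  qed
  fix P Q
  show "?f (ec_add A P Q) = ec_add (A * u ^ 4) (?f P) (?f Q)"
  proof (cases P; cases Q)
    fix x1 y1 x2 y2 assume PQ: "P = EC_Affine x1 y1" "Q = EC_Affine x2 y2"
    define m where "m = (if x1 = x2 then (3 * x1 ^ 2 + A) / (2 * y1) else (y2 - y1) / (x2 - x1))"
    \<comment> \<open>For \<open>x1 = x2\<close> and \<open>y1 = 0\<close> both quotients are 0 by
      the convention on division, so the slopes correspond in this case too.\<close>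
    have m: "(if u ^ 2 * x1 = u ^ 2 * x2 then (3 * (u ^ 2 * x1) ^ 2 + A * u ^ 4) / (2 * (u ^ 3 * y1))
        else (u ^ 3 * y2 - u ^ 3 * y1) / (u ^ 2 * x2 - u ^ 2 * x1)) = u * m"
      using assms by (auto simp: m_def divide_simps) (simp_all add: algebra_simps eval_nat_numeral)
    have opp: "(u ^ 2 * x1 = u ^ 2 * x2 \<and> u ^ 3 * y1 = - (u ^ 3 * y2)) \<longleftrightarrow> (x1 = x2 \<and> y1 = - y2)"
      using assms(2) by (metis mult_cancel_left mult_minus_right power_not_zero)
    show "?f (ec_add A P Q) = ec_add (A * u ^ 4) (?f P) (?f Q)"
      unfolding PQ ec_map.simps ec_add.simps m m_def[symmetric] opp
      by (simp add: Let_def) (simp add: algebra_simps eval_nat_numeral)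
  qed auto
qed

text \<open>Equation and group law are built from field operations and integer constants, all of
  which \<open>\<sigma>\<close> respects, including division by 0. The Frobenius map is the intended
  instance.\<close>

lemma ec_group_iso_ring_automorphism:
  fixes A B :: "'a::field" and \<sigma> :: "'a \<Rightarrow> 'a"
  assumes \<sigma>: "bij \<sigma>" "\<And>x y. \<sigma> (x + y) = \<sigma> x + \<sigma> y" "\<And>x y. \<sigma> (x * y) = \<sigma> x * \<sigma> y"
  shows "ec_group A B \<cong> ec_group (\<sigma> A) (\<sigma> B)"
proof (rule is_isoI_bij[of "ec_map \<sigma> \<sigma>"]; simp)
  have inj: "\<sigma> x = \<sigma> y \<longleftrightarrow> x = y" for x y
    using \<sigma>(1) by (auto simp: bij_def inj_def)
  have s0: "\<sigma> 0 = 0"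
    using \<sigma>(2)[of 0 0] by (metis add.right_neutral add_left_cancel)
  have s1: "\<sigma> 1 = 1" using \<sigma>(3)[of 1 1] inj[of 1 0] s0 by simp
  have sneg: "\<sigma> (- x) = - \<sigma> x" for x
    using \<sigma>(2)[of x "- x"] s0 by (simp add: eq_neg_iff_add_eq_0 add.commute)
  have sdiff: "\<sigma> (x - y) = \<sigma> x - \<sigma> y" for x y
    using \<sigma>(2)[of x "- y"] sneg by simp
  have sinv: "\<sigma> (inverse x) = inverse (\<sigma> x)" for x
    by (metis \<sigma>(3) s0 s1 inverse_unique inverse_zero right_inverse)
  have sdiv: "\<sigma> (x / y) = \<sigma> x / \<sigma> y" for x y
    by (simp add: divide_inverse \<sigma>(3) sinv)
  have spow: "\<sigma> (x ^ n) = \<sigma> x ^ n" for x n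
    by (induction n) (simp_all add: s1 \<sigma>(3))
  have snum: "\<sigma> 2 = 2" "\<sigma> 3 = 3"
    using \<sigma>(2)[of 1 1] \<sigma>(2)[of 2 1] s1 by simp_all
  note simps = \<sigma>(2,3) sneg sdiff sdiv spow snum
  have on_curve: "\<sigma> y ^ 2 = \<sigma> x ^ 3 + \<sigma> A * \<sigma> x + \<sigma> B \<longleftrightarrow> y ^ 2 = x ^ 3 + A * x + B" for x y
    using inj[of "y ^ 2" "x ^ 3 + A * x + B"] by (simp add: simps)
  have sinvf: "\<sigma> (inv_into UNIV \<sigma> x) = x" "inv_into UNIV \<sigma> (\<sigma> x) = x" for x
    using \<sigma>(1) by (simp_all add: bij_is_surj bij_is_inj surj_f_inv_f inv_f_f)
  show "bij_betw (ec_map \<sigma> \<sigma>) (ec_points A B) (ec_points (\<sigma> A) (\<sigma> B))"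
  proof (rule bij_betwI[of _ _ _ "ec_map (inv_into UNIV \<sigma>) (inv_into UNIV \<sigma>)"])
    show "ec_map \<sigma> \<sigma> \<in> ec_points A B \<rightarrow> ec_points (\<sigma> A) (\<sigma> B)"
    proof
      fix P assume "P \<in> ec_points A B"
      thus "ec_map \<sigma> \<sigma> P \<in> ec_points (\<sigma> A) (\<sigma> B)"
        by (cases P) (simp_all add: on_curve)
    qed
    show "ec_map (inv_into UNIV \<sigma>) (inv_into UNIV \<sigma>) \<in> ec_points (\<sigma> A) (\<sigma> B) \<rightarrow> ec_points A B"
    proof
      fix P assume P: "P \<in> ec_points (\<sigma> A) (\<sigma> B)"
      show "ec_map (inv_into UNIV \<sigma>) (inv_into UNIV \<sigma>) P \<in> ec_points A B"
      proof (cases P)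
        case (EC_Affine x y)
        thus ?thesis
          using P on_curve[of "inv_into UNIV \<sigma> y" "inv_into UNIV \<sigma> x"] by (simp add: sinvf)
      qed simp
    qed
    show "ec_map (inv_into UNIV \<sigma>) (inv_into UNIV \<sigma>) (ec_map \<sigma> \<sigma> P) = P" for P
      by (cases P) (simp_all add: sinvf)
    show "ec_map \<sigma> \<sigma> (ec_map (inv_into UNIV \<sigma>) (inv_into UNIV \<sigma>) P) = P" for P
      by (cases P) (simp_all add: sinvf)
  qed
  fix P Q
  show "ec_map \<sigma> \<sigma> (ec_add A P Q) = ec_add (\<sigma> A) (ec_map \<sigma> \<sigma> P) (ec_map \<sigma> \<sigma> Q)"
  proof (cases P; cases Q)
    fix x1 y1 x2 y2 assume PQ: "P = EC_Affine x1 y1" "Q = EC_Affine x2 y2"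
    have opp: "(\<sigma> x1 = \<sigma> x2 \<and> \<sigma> y1 = - \<sigma> y2) \<longleftrightarrow> (x1 = x2 \<and> y1 = - y2)"
      by (metis inj sneg)
    show ?thesis
      unfolding PQ ec_map.simps ec_add.simps opp
      by (simp add: Let_def simps inj)
  qed auto
qed

section \<open>The 3-isogeny\<close>

text \<open>The standard isogeny of degree 3 from \<open>y^2 = x^3 + B\<close> to
  \<open>y^2 = x^3 - 27 B\<close>; its kernel consists of infinity and the points with
  \<open>x = 0\<close>, whose ordinates are the square roots of \<open>B\<close>. At
  \<open>x = 0\<close> the formula yields (0, 0) instead of infinity, but for nonsquare
  \<open>B\<close> no rational point has \<open>x = 0\<close>.\<close>

definition isog3 :: "'a::field \<Rightarrow> 'a ec_point \<Rightarrow> 'a ec_point" where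
  "isog3 B P = (case P of EC_Infinity \<Rightarrow> EC_Infinity
     | EC_Affine x y \<Rightarrow> EC_Affine ((x ^ 3 + 4 * B) / x ^ 2) (y * (x ^ 3 - 8 * B) / x ^ 3))"

lemma isog3_simps [simp]:
  "isog3 B EC_Infinity = EC_Infinity"
  "isog3 B (EC_Affine x y) =
     EC_Affine ((x ^ 3 + 4 * B) / x ^ 2) (y * (x ^ 3 - 8 * B) / x ^ 3)"
  by (simp_all add: isog3_def)

text \<open>With \<open>t = x^3\<close> this is the identity
  \<open>(t + B) (t - 8 B)^2 = (t + 4 B)^3 - 27 B t^2\<close>, divided by
  \<open>x^6\<close>.\<close>

lemma isog3_in_points:
  fixes B x y :: "'a::field"
  assumes "y ^ 2 = x ^ 3 + B" "x \<noteq> 0"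
  shows "(y * (x ^ 3 - 8 * B) / x ^ 3) ^ 2 = ((x ^ 3 + 4 * B) / x ^ 2) ^ 3 + - 27 * B"
proof -
  have "(y * (x ^ 3 - 8 * B) / x ^ 3) ^ 2 = y ^ 2 * (x ^ 3 - 8 * B) ^ 2 / x ^ 6"
    by (simp add: power_divide power_mult_distrib flip: power_mult)
  also have "\<dots> = ((x ^ 3 + 4 * B) ^ 3 - 27 * B * x ^ 6) / x ^ 6"
    unfolding assms(1) by (simp add: algebra_simps eval_nat_numeral)
  also have "\<dots> = ((x ^ 3 + 4 * B) / x ^ 2) ^ 3 + - 27 * B"
    using assms(2) by (simp add: power_divide diff_divide_distrib flip: power_mult)
  finally show ?thesis .
qed

text \<open>The intersections of \<open>y = m x + n\<close> with \<open>E\<^sub>B\<close> are mapped to a line; slope and intercept come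
  from matching the quartic in the proof with a multiple of the cubic that cuts out the intersections.\<close>

lemma isog3_line:
  fixes B x m n :: "'a::field"
  defines "D \<equiv> n ^ 2 - B"
  assumes "(m * x + n) ^ 2 = x ^ 3 + B" "x \<noteq> 0" "D \<noteq> 0"
  shows "(m * x + n) * (x ^ 3 - 8 * B) / x ^ 3 =
    m * (n ^ 2 + 3 * B) / D * ((x ^ 3 + 4 * B) / x ^ 2) + (n - (8 * B * n + 4 * B * m ^ 3) / D)"
proof -
  have "(m * x + n) * (x ^ 3 - 8 * B) * D
      - (m * (n ^ 2 + 3 * B) * x * (x ^ 3 + 4 * B) + (n * D - (8 * B * n + 4 * B * m ^ 3)) * x ^ 3)
      = (x ^ 3 + B - (m * x + n) ^ 2) * (8 * B * n - 4 * B * m * x)"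
    by (simp add: D_def algebra_simps eval_nat_numeral)
  also have "\<dots> = 0" using assms(2) by simp
  finally have "(m * x + n) * (x ^ 3 - 8 * B) * D =
      m * (n ^ 2 + 3 * B) * x * (x ^ 3 + 4 * B) + (n * D - (8 * B * n + 4 * B * m ^ 3)) * x ^ 3"
    by simp
  \<comment> \<open>Denominators are cleared with abstract numerators, so that the polynomials above
    are not expanded.\<close>
  moreover have "a / x ^ 3 = b / D * (c / x ^ 2) + (n - d / D)"
    if "a * D = b * x * c + (n * D - d) * x ^ 3" for a b c d
  proof -
    have "a / x ^ 3 = a * D / (x ^ 3 * D)" using assms by simp
    also have "\<dots> = b / D * (c / x ^ 2) + (n - d / D)"
      unfolding that using assms by (simp add: divide_simps) (simp add: algebra_simps eval_nat_numeral)
    finally show ?thesis .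
  qed
  ultimately show ?thesis by blast
qed

text \<open>The hypotheses are Vieta's relations for the abscissas where \<open>y = m x + n\<close>
  meets the curve. Since the image abscissa is \<open>x + 4 B / x^2\<close>, the sum is symmetric in
  the roots; it equals the squared slope of the image line, as the addition law demands.\<close>

lemma isog3_line_sum:
  fixes B m n x1 x2 x3 :: "'a::field"
  defines "D \<equiv> n ^ 2 - B"
  assumes e1: "x1 + x2 + x3 = m ^ 2" and e2: "x1 * x2 + x1 * x3 + x2 * x3 = - (2 * m * n)"
    and e3: "x1 * x2 * x3 = D" and "D \<noteq> 0"
  shows "(x1 ^ 3 + 4 * B) / x1 ^ 2 + (x2 ^ 3 + 4 * B) / x2 ^ 2 + (x3 ^ 3 + 4 * B) / x3 ^ 2
    = (m * (n ^ 2 + 3 * B) / D) ^ 2"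
proof -
  have nz: "x1 \<noteq> 0" "x2 \<noteq> 0" "x3 \<noteq> 0" using e3 \<open>D \<noteq> 0\<close> by auto
  have X: "(x ^ 3 + 4 * B) / x ^ 2 = x + 4 * B / x ^ 2" if "x \<noteq> 0" for x
    using that by (simp add: field_simps eval_nat_numeral)
  have "1 / x1 ^ 2 + 1 / x2 ^ 2 + 1 / x3 ^ 2 =
      ((x1 * x2 + x1 * x3 + x2 * x3) ^ 2 - 2 * (x1 + x2 + x3) * (x1 * x2 * x3)) / (x1 * x2 * x3) ^ 2"
    using nz by (simp add: divide_simps) (simp add: algebra_simps eval_nat_numeral)
  also have "\<dots> = (4 * m ^ 2 * n ^ 2 - 2 * m ^ 2 * D) / D ^ 2"
    unfolding e1 e2 e3 by (simp add: power2_eq_square algebra_simps)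
  finally have inv: "1 / x1 ^ 2 + 1 / x2 ^ 2 + 1 / x3 ^ 2 = (4 * m ^ 2 * n ^ 2 - 2 * m ^ 2 * D) / D ^ 2" .
  have "(x1 ^ 3 + 4 * B) / x1 ^ 2 + (x2 ^ 3 + 4 * B) / x2 ^ 2 + (x3 ^ 3 + 4 * B) / x3 ^ 2
      = (x1 + x2 + x3) + 4 * B * (1 / x1 ^ 2 + 1 / x2 ^ 2 + 1 / x3 ^ 2)"
    unfolding X[OF nz(1)] X[OF nz(2)] X[OF nz(3)] by (simp add: algebra_simps)
  also have "\<dots> = (m ^ 2 * D ^ 2 + 4 * B * (4 * m ^ 2 * n ^ 2 - 2 * m ^ 2 * D)) / D ^ 2"
    unfolding e1 inv using \<open>D \<noteq> 0\<close> by (simp add: field_simps)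
  also have "m ^ 2 * D ^ 2 + 4 * B * (4 * m ^ 2 * n ^ 2 - 2 * m ^ 2 * D) = (m * (n ^ 2 + 3 * B)) ^ 2"
    by (simp add: D_def algebra_simps eval_nat_numeral)
  finally show ?thesis by (simp add: power_divide)
qed

section \<open>Injectivity of the isogeny for nonsquare \<open>B\<close>\<close>

text \<open>Points whose images agree up to sign agree up to sign and a kernel point, and the affine
  kernel points are rational only if \<open>B\<close> is a square. Concretely,
  \<open>x1 \<noteq> x2\<close> yields an explicit square root of \<open>B\<close>.\<close>

lemma isog3_x_inj:
  fixes B :: "'a::field"
  assumes "(3::'a) \<noteq> 0" and nonsq: "\<And>b. b ^ 2 \<noteq> B"
    and c1: "y1 ^ 2 = x1 ^ 3 + B" and c2: "y2 ^ 2 = x2 ^ 3 + B"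
    and eq: "(x1 ^ 3 + 4 * B) / x1 ^ 2 = (x2 ^ 3 + 4 * B) / x2 ^ 2" and nz: "(2::'a) \<noteq> 0"
  shows "x1 = x2"
proof (rule ccontr)
  assume ne: "x1 \<noteq> x2"
  have x0: "x1 \<noteq> 0" "x2 \<noteq> 0" using c1 c2 nonsq by auto
  have "(x1 ^ 3 + 4 * B) * x2 ^ 2 - (x2 ^ 3 + 4 * B) * x1 ^ 2 = 0"
    using eq x0 by (simp add: frac_eq_eq)
  also have "(x1 ^ 3 + 4 * B) * x2 ^ 2 - (x2 ^ 3 + 4 * B) * x1 ^ 2 =
      (x1 - x2) * (x1 ^ 2 * x2 ^ 2 - 4 * B * (x1 + x2))"
    by (simp add: algebra_simps eval_nat_numeral)
  finally have s: "x1 ^ 2 * x2 ^ 2 = 4 * B * (x1 + x2)"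
    using ne by simp
  \<comment> \<open>The relation \<open>s\<close> is quadratic in \<open>x2\<close>; it is
    multiplied by \<open>x1^2\<close> and completed to a square.\<close>
  have "(x1 ^ 2 * x2 - 2 * B) ^ 2 = x1 ^ 2 * (x1 ^ 2 * x2 ^ 2) - 4 * B * x1 ^ 2 * x2 + 4 * B ^ 2"
    by (simp add: algebra_simps eval_nat_numeral)
  also have "\<dots> = 4 * B * (x1 ^ 3 + B)"
    unfolding s by (simp add: algebra_simps eval_nat_numeral)
  finally have sq: "(x1 ^ 2 * x2 - 2 * B) ^ 2 = B * (2 * y1) ^ 2"
    unfolding c1[symmetric] by (simp add: power_mult_distrib)
  show False
  proof (cases "y1 = 0")
    case False
    hence "((x1 ^ 2 * x2 - 2 * B) / (2 * y1)) ^ 2 = B"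
      unfolding power_divide sq using nz
      by (metis nonzero_mult_div_cancel_right mult_eq_0_iff power_not_zero)
    thus False using nonsq by blast
  next
    case True
    \<comment> \<open>Here \<open>2 * y1\<close> cannot be divided out; the root of \<open>B\<close>
      comes from the second point instead, as \<open>y2 / 3\<close>.\<close>
    have B: "B = - (x1 ^ 3)" using c1 True by (simp add: eq_neg_iff_add_eq_0 add.commute)
    have "x1 ^ 2 * x2 = 2 * B" using sq True by simp
    hence "x1 ^ 2 * (x2 + 2 * x1) = 0"
      unfolding B by (simp add: algebra_simps eval_nat_numeral)
    hence x2: "x2 = - (2 * x1)" using x0 by (simp add: add_eq_0_iff2)
    have "y2 ^ 2 = 3 ^ 2 * B" using c2 unfolding x2 B by (simp add: power_mult_distrib)
    hence "(y2 / 3) ^ 2 = B"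
      unfolding power_divide using assms(1) by (metis nonzero_mult_div_cancel_left power_not_zero)
    thus False using nonsq by blast
  qed
qed

text \<open>Otherwise \<open>y^2 = 9 B\<close>, and \<open>y / 3\<close> would be a square root of
  \<open>B\<close>. Hence the image ordinate vanishes only where \<open>y\<close> does.\<close>

lemma isog3_y_factor_nonzero:
  fixes B x y :: "'a::field"
  assumes "(3::'a) \<noteq> 0" "\<And>b. b ^ 2 \<noteq> B" "y ^ 2 = x ^ 3 + B"
  shows "x ^ 3 - 8 * B \<noteq> 0"
proof
  assume "x ^ 3 - 8 * B = 0"
  hence "y ^ 2 = 3 ^ 2 * B" using assms(3) by simp
  hence "(y / 3) ^ 2 = B"
    unfolding power_divide using assms(1) by (metis nonzero_mult_div_cancel_left power_not_zero)
  thus False using assms(2) by blast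
qed

section \<open>Compatibility of the isogeny with addition\<close>

text \<open>Tangents go to tangents: the right-hand side is the slope of the image line in
  \<open>isog3_line\<close>. Multiplying its numerator and denominator by \<open>4 y^2\<close>
  eliminates \<open>n\<close> and leaves the doubling slope at the image.\<close>

lemma isog3_slope_tangent:
  fixes B m n x y :: "'a::field"
  assumes "(2::'a) \<noteq> 0" "y ^ 2 = x ^ 3 + B" "y \<noteq> 0" "x \<noteq> 0" "x ^ 3 - 8 * B \<noteq> 0"
    and m: "2 * y * m = 3 * x ^ 2" and n: "n = y - m * x"
  shows "3 * ((x ^ 3 + 4 * B) / x ^ 2) ^ 2 / (2 * (y * (x ^ 3 - 8 * B) / x ^ 3))
    = m * (n ^ 2 + 3 * B) / (n ^ 2 - B)"
proof -
  have "2 * y * n = 2 * y ^ 2 - 2 * y * m * x"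
    by (simp add: n algebra_simps power2_eq_square)
  hence yn: "2 * y * n = 2 * B - x ^ 3"
    unfolding m assms(2) by (simp add: algebra_simps eval_nat_numeral)
  have "4 * y ^ 2 * n ^ 2 = (2 * y * n) ^ 2" by (simp add: power_mult_distrib)
  hence yn2: "4 * y ^ 2 * n ^ 2 = (2 * B - x ^ 3) ^ 2" unfolding yn .
  have a: "4 * y ^ 2 * (n ^ 2 - B) = x ^ 3 * (x ^ 3 - 8 * B)"
  proof -
    have "4 * y ^ 2 * (n ^ 2 - B) = 4 * y ^ 2 * n ^ 2 - 4 * B * y ^ 2" by (simp add: algebra_simps)
    thus ?thesis unfolding yn2 unfolding assms(2) by (simp add: algebra_simps eval_nat_numeral)
  qed
  have b: "4 * y ^ 2 * (n ^ 2 + 3 * B) = (x ^ 3 + 4 * B) ^ 2"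
  proof -
    have "4 * y ^ 2 * (n ^ 2 + 3 * B) = 4 * y ^ 2 * n ^ 2 + 12 * B * y ^ 2" by (simp add: algebra_simps)
    thus ?thesis unfolding yn2 unfolding assms(2) by (simp add: algebra_simps eval_nat_numeral)
  qed
  have y4: "4 * y ^ 2 \<noteq> 0"
  proof -
    have "4 * y ^ 2 = (2 * y) ^ 2" by (simp add: power_mult_distrib)
    moreover have "(2 * y) ^ 2 \<noteq> 0" using assms(1,3) by (metis mult_eq_0_iff power_not_zero)
    ultimately show ?thesis by metis
  qed
  have m': "m = 3 * x ^ 2 / (2 * y)"
    using assms by (simp add: field_simps)
  have "m * (n ^ 2 + 3 * B) / (n ^ 2 - B) =
      m * (4 * y ^ 2 * (n ^ 2 + 3 * B)) / (4 * y ^ 2 * (n ^ 2 - B))"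
    using y4 by simp
  also have "\<dots> = m * (x ^ 3 + 4 * B) ^ 2 / (x ^ 3 * (x ^ 3 - 8 * B))"
    unfolding a b ..
  also have "m * (x ^ 3 + 4 * B) ^ 2 / (x ^ 3 * (x ^ 3 - 8 * B)) =
      3 * ((x ^ 3 + 4 * B) / x ^ 2) ^ 2 / (2 * (y * (x ^ 3 - 8 * B) / x ^ 3))"
    unfolding m' using assms by (simp add: divide_simps power_divide)
  finally show ?thesis ..
qed

text \<open>Three collinear points of the curve have collinear images, and the image abscissas add
  up to the square of the new slope \<open>M\<close>. So the third intersection of the image line is
  the image of the third intersection.\<close>

lemma isog3_add:
  fixes B :: "'a::field"
  assumes two: "(2::'a) \<noteq> 0" and three: "(3::'a) \<noteq> 0" and nonsq: "\<And>b. b ^ 2 \<noteq> B"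
    and P: "P \<in> ec_points 0 B" and Q: "Q \<in> ec_points 0 B"
  shows "isog3 B (ec_add 0 P Q) = ec_add 0 (isog3 B P) (isog3 B Q)"
proof (cases "\<exists>x1 y1 x2 y2. P = EC_Affine x1 y1 \<and> Q = EC_Affine x2 y2 \<and> \<not> (x1 = x2 \<and> y1 = - y2)")
  \<comment> \<open>What remains are pairs with a point at infinity and opposite pairs; the latter
    stay opposite because the second coordinate of the map is odd in \<open>y\<close>.\<close>
  case False
  thus ?thesis by (cases P; cases Q) auto
next
  case True
  then obtain x1 y1 x2 y2 where PQ: "P = EC_Affine x1 y1" "Q = EC_Affine x2 y2"
    and nopp: "\<not> (x1 = x2 \<and> y1 = - y2)" by blast
  have c1: "y1 ^ 2 = x1 ^ 3 + B" and c2: "y2 ^ 2 = x2 ^ 3 + B" using P Q PQ by simp_all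
  have x0: "x1 \<noteq> 0" "x2 \<noteq> 0" using c1 c2 nonsq by auto
  have x8: "x1 ^ 3 - 8 * B \<noteq> 0"
    by (rule isog3_y_factor_nonzero[OF three nonsq c1])
  define m where "m = (if x1 = x2 then 3 * x1 ^ 2 / (2 * y1) else (y2 - y1) / (x2 - x1))"
  define n where "n = y1 - m * x1"
  define x3 where "x3 = m ^ 2 - x1 - x2"
  define D where "D = n ^ 2 - B"
  have y12: "y2 = y1 \<and> y1 \<noteq> 0" if "x1 = x2"
  proof -
    have "(y1 - y2) * (y1 + y2) = 0"
      using c1 c2 that by (simp add: algebra_simps power2_eq_square)
    thus ?thesis using nopp that by (auto simp: add_eq_0_iff2)
  qed
  have m_tangent: "2 * y1 * m = 3 * x1 ^ 2" if "x1 = x2"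
    using that y12 two by (simp add: m_def)
  have y1: "y1 = m * x1 + n" by (simp add: n_def)
  have y2: "y2 = m * x2 + n"
    using y12 by (cases "x1 = x2") (simp_all add: n_def m_def divide_simps, simp add: algebra_simps)
  have sum_eq: "x1 ^ 2 + x1 * x2 + x2 ^ 2 = m * (y1 + y2)"
  proof (cases "x1 = x2")
    case True
    thus ?thesis using m_tangent y12 by (simp add: algebra_simps power2_eq_square)
  next
    case False
    have "m * (x2 - x1) = y2 - y1" using False by (simp add: m_def)
    moreover have "(x2 - x1) * (x1 ^ 2 + x1 * x2 + x2 ^ 2 - m * (y1 + y2))
        = (x2 ^ 3 + B) - (x1 ^ 3 + B) - m * (x2 - x1) * (y1 + y2)"
      by (simp add: algebra_simps eval_nat_numeral)
    ultimately have "(x2 - x1) * (x1 ^ 2 + x1 * x2 + x2 ^ 2 - m * (y1 + y2))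
        = y2 ^ 2 - y1 ^ 2 - (y2 - y1) * (y1 + y2)"
      unfolding c1[symmetric] c2[symmetric] by metis
    hence "(x2 - x1) * (x1 ^ 2 + x1 * x2 + x2 ^ 2 - m * (y1 + y2)) = 0"
      by (simp add: algebra_simps power2_eq_square)
    thus ?thesis using False by simp
  qed
  \<comment> \<open>Vieta's relations for the cubic \<open>x^3 + B - (m x + n)^2\<close> with roots
    \<open>x1\<close>, \<open>x2\<close>, \<open>x3\<close>.\<close>
  have e1: "x1 + x2 + x3 = m ^ 2" by (simp add: x3_def)
  have e2: "x1 * x2 + x1 * x3 + x2 * x3 = - (2 * m * n)"
  proof -
    have "x1 * x2 + x1 * x3 + x2 * x3 = m ^ 2 * (x1 + x2) - (x1 ^ 2 + x1 * x2 + x2 ^ 2)"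
      by (simp add: x3_def algebra_simps power2_eq_square)
    also have "\<dots> = - (2 * m * n)"
      unfolding sum_eq unfolding y1 y2 by (simp add: algebra_simps power2_eq_square)
    finally show ?thesis .
  qed
  have e3: "x1 * x2 * x3 = D"
  proof -
    have "x1 * x2 * x3 = x1 * (x1 * x2 + x1 * x3 + x2 * x3) - x1 ^ 2 * (x1 + x2 + x3) + x1 ^ 3"
      by (simp add: algebra_simps eval_nat_numeral)
    also have "\<dots> = n ^ 2 - (m * x1 + n) ^ 2 + x1 ^ 3"
      unfolding e1 e2 by (simp add: algebra_simps eval_nat_numeral)
    also have "\<dots> = D" using c1 unfolding y1[symmetric] D_def by simp
    finally show ?thesis .
  qed
  have D0: "D \<noteq> 0" using nonsq[of n] by (simp add: D_def)
  have x30: "x3 \<noteq> 0" using e3 D0 by auto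
  have add: "ec_add 0 P Q = EC_Affine x3 (- (m * x3 + n))"
  proof -
    have "m = (if x1 = x2 then (3 * x1 ^ 2 + 0) / (2 * y1) else (y2 - y1) / (x2 - x1))"
      by (simp add: m_def)
    note this [symmetric]
    show ?thesis
      unfolding PQ ec_add.simps Let_def \<open>_ = m\<close> x3_def[symmetric]
      using nopp by (simp add: n_def algebra_simps)
  qed
  have c3: "(m * x3 + n) ^ 2 = x3 ^ 3 + B"
    using ec_add_closed[OF two P Q] unfolding add EC_Affine_in_points_iff power2_minus by simp
  define X where "X = (\<lambda>x. (x ^ 3 + 4 * B) / x ^ 2)"
  define Y where "Y = (\<lambda>x y. y * (x ^ 3 - 8 * B) / x ^ 3)"
  define M where "M = m * (n ^ 2 + 3 * B) / D"
  define N where "N = n - (8 * B * n + 4 * B * m ^ 3) / D"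
  have Y: "Y x (m * x + n) = M * X x + N" if "(m * x + n) ^ 2 = x ^ 3 + B" "x \<noteq> 0" for x
    using isog3_line[OF that, folded D_def] D0 by (simp add: X_def Y_def M_def N_def)
  have Y1: "Y x1 y1 = M * X x1 + N" using Y[of x1] c1 x0 y1 by simp
  have Y2: "Y x2 y2 = M * X x2 + N" using Y[of x2] c2 x0 y2 by simp
  have Y3: "Y x3 (- (m * x3 + n)) = - (M * X x3 + N)"
  proof -
    have "Y x3 (- (m * x3 + n)) = - Y x3 (m * x3 + n)"
      by (simp only: Y_def mult_minus_left minus_divide_left)
    thus ?thesis using Y[OF c3 x30] by metis
  qed
  have sumX: "X x1 + X x2 + X x3 = M ^ 2"
    using isog3_line_sum[of x1 x2 x3 m n B] e1 e2 e3 D0 by (simp add: X_def M_def D_def)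
  \<comment> \<open>This makes the sum and the sum of the images use the same kind of slope, chord
    or tangent.\<close>
  have Xeq: "X x1 = X x2 \<longleftrightarrow> x1 = x2"
    using isog3_x_inj[OF three nonsq c1 c2 _ two] by (auto simp: X_def)
  have slope: "(if X x1 = X x2 then (3 * X x1 ^ 2 + 0) / (2 * Y x1 y1)
      else (Y x2 y2 - Y x1 y1) / (X x2 - X x1)) = M"
  proof (cases "x1 = x2")
    case True
    thus ?thesis
      using isog3_slope_tangent[OF two c1 _ x0(1) x8 m_tangent n_def] y12
      by (simp add: X_def Y_def M_def D_def)
  next
    case False
    hence "X x2 - X x1 \<noteq> 0" using Xeq by simp
    thus ?thesis using False Xeq unfolding Y1 Y2
      by (simp add: divide_simps) (simp add: algebra_simps)
  qed
  have opp: "\<not> (X x1 = X x2 \<and> Y x1 y1 = - Y x2 y2)"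
  proof
    assume *: "X x1 = X x2 \<and> Y x1 y1 = - Y x2 y2"
    hence "x1 = x2" using Xeq by simp
    hence "Y x1 y1 + Y x1 y1 = 0" using * y12 by (metis eq_neg_iff_add_eq_0)
    hence "2 * Y x1 y1 = 0" unfolding mult_2 .
    hence "Y x1 y1 = 0" using two by simp
    thus False using x8 x0 y12[OF \<open>x1 = x2\<close>] by (simp add: Y_def)
  qed
  have X3: "M ^ 2 - X x1 - X x2 = X x3" using sumX by (simp add: algebra_simps)
  have "ec_add 0 (isog3 B P) (isog3 B Q) = ec_add 0 (EC_Affine (X x1) (Y x1 y1)) (EC_Affine (X x2) (Y x2 y2))"
    by (simp add: PQ X_def Y_def)
  also have "\<dots> = EC_Affine (X x3) (M * (X x1 - X x3) - Y x1 y1)"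
    unfolding ec_add.simps slope Let_def X3 using opp by simp
  also have "M * (X x1 - X x3) - Y x1 y1 = Y x3 (- (m * x3 + n))"
    unfolding Y1 Y3 by (simp add: algebra_simps)
  finally show ?thesis by (simp add: add X_def Y_def)
qed

lemma isog3_inj:
  fixes B :: "'a::field"
  assumes two: "(2::'a) \<noteq> 0" and three: "(3::'a) \<noteq> 0" and nonsq: "\<And>b. b ^ 2 \<noteq> B"
  shows "inj_on (isog3 B) (ec_points 0 B)"
proof (rule inj_onI)
  fix P Q assume PQ: "P \<in> ec_points 0 B" "Q \<in> ec_points 0 B" "isog3 B P = isog3 B Q"
  show "P = Q"
  proof (cases P; cases Q)
    fix x1 y1 x2 y2 assume eq: "P = EC_Affine x1 y1" "Q = EC_Affine x2 y2"
    have c1: "y1 ^ 2 = x1 ^ 3 + B" and c2: "y2 ^ 2 = x2 ^ 3 + B" using PQ eq by simp_all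
    have x: "x1 = x2" using isog3_x_inj[OF three nonsq c1 c2 _ two] PQ eq by simp
    have "x1 ^ 3 - 8 * B \<noteq> 0"
      by (rule isog3_y_factor_nonzero[OF three nonsq c1])
    moreover have "x1 \<noteq> 0" using c1 nonsq by auto
    ultimately show "P = Q" using PQ eq x by (simp add: divide_simps)
  qed (use PQ in auto)
qed

text \<open>An injective homomorphism between finite groups of equal size is bijective.\<close>

lemma ec_group_iso_isog3:
  fixes B :: "'a::{field,finite}"
  assumes two: "(2::'a) \<noteq> 0" and three: "(3::'a) \<noteq> 0" and nonsq: "\<And>b. b ^ 2 \<noteq> B"
    and card: "card (ec_points 0 B) = card (ec_points 0 (- 27 * B))"
    and fin: "finite (ec_points 0 (- 27 * B))"
  shows "ec_group 0 B \<cong> ec_group 0 (- 27 * B)"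
proof (rule is_isoI_bij[of "isog3 B"]; simp del: mult_minus_left)
  have "isog3 B ` ec_points 0 B \<subseteq> ec_points 0 (- 27 * B)"
  proof
    fix Q assume "Q \<in> isog3 B ` ec_points 0 B"
    then obtain P where P: "P \<in> ec_points 0 B" "Q = isog3 B P" by blast
    show "Q \<in> ec_points 0 (- 27 * B)"
    proof (cases P)
      case (EC_Affine x y)
      hence c: "y ^ 2 = x ^ 3 + B" using P by simp
      hence "x \<noteq> 0" using nonsq by auto
      from isog3_in_points[OF c this] show ?thesis using P EC_Affine by simp
    qed (use P in simp)
  qed
  moreover note inj = isog3_inj[OF two three nonsq]
  ultimately have "isog3 B ` ec_points 0 B = ec_points 0 (- 27 * B)"
    using card fin by (intro card_subset_eq) (simp_all add: card_image del: mult_minus_left)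
  thus "bij_betw (isog3 B) (ec_points 0 B) (ec_points 0 (- 27 * B))"
    using inj by (simp add: bij_betw_def)
qed (rule isog3_add[OF two three nonsq])

section \<open>Generators and point counts over finite fields\<close>

definition field_generator :: "'a::field \<Rightarrow> bool" where
  "field_generator g \<longleftrightarrow> g \<noteq> 0 \<and> (\<forall>x. x \<noteq> 0 \<longrightarrow> (\<exists>i::nat. x = g ^ i))"

lemma field_generator_powE:
  assumes "field_generator g" "x \<noteq> 0"
  obtains i :: nat where "x = g ^ i"
  using assms by (auto simp: field_generator_def)

text \<open>A bridge from the type class to the record-based rings, for which the multiplicative
  group of a finite field is known to be cyclic.\<close>

definition ring_of_type :: "'a::field itself \<Rightarrow> 'a ring" where
  "ring_of_type _ = \<lparr>carrier = UNIV, monoid.mult = (*), one = 1, zero = 0, add = (+)\<rparr>"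

lemma field_ring_of_type: "Ring.field (ring_of_type TYPE('a::field))"
proof -
  let ?R = "ring_of_type TYPE('a)"
  have "abelian_group ?R"
    by (rule abelian_groupI) (auto simp: ring_of_type_def algebra_simps intro: exI[of _ "- _"] ab_left_minus)
  moreover have "comm_monoid ?R"
    by (rule comm_monoidI) (auto simp: ring_of_type_def algebra_simps)
  ultimately have "cring ?R"
    by (rule cringI) (auto simp: ring_of_type_def algebra_simps)
  thus ?thesis
  proof (rule cring.cring_fieldI2)
    show "\<zero>\<^bsub>?R\<^esub> \<noteq> \<one>\<^bsub>?R\<^esub>" by (simp add: ring_of_type_def)
    fix a assume "a \<in> carrier ?R" "a \<noteq> \<zero>\<^bsub>?R\<^esub>"
    hence "a * inverse a = 1" by (simp add: ring_of_type_def)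
    thus "\<exists>b\<in>carrier ?R. a \<otimes>\<^bsub>?R\<^esub> b = \<one>\<^bsub>?R\<^esub>"
      by (auto simp: ring_of_type_def)
  qed
qed

lemma ring_of_type_pow: "x [^]\<^bsub>ring_of_type TYPE('a::field)\<^esub> (n::nat) = x ^ n"
  by (induction n) (simp_all add: nat_pow_def ring_of_type_def mult.commute)

lemma ex_field_generator: "\<exists>g::'a::{field,finite}. field_generator g"
proof -
  interpret R: Ring.field "ring_of_type TYPE('a)" by (rule field_ring_of_type)
  have carrier: "carrier (mult_of (ring_of_type TYPE('a))) = UNIV - {0}"
    by (simp add: ring_of_type_def)
  have "finite (carrier (ring_of_type TYPE('a)))" by simp
  from R.finite_field_mult_group_has_gen[OF this, unfolded ring_of_type_pow carrier]
  obtain g :: 'a where "g \<in> UNIV - {0}" "UNIV - {0} = {g ^ i | i::nat. i \<in> UNIV}"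
    by blast
  hence "field_generator g" by (auto simp: field_generator_def)
  thus ?thesis ..
qed

text \<open>Multiplication by \<open>x\<close> permutes the nonzero elements; comparing their
  product before and after gives the claim.\<close>

lemma finite_field_pow_card_minus_1:
  fixes x :: "'a::{field,finite}"
  assumes "x \<noteq> 0"
  shows "x ^ (CARD('a) - 1) = 1"
proof -
  have bij: "bij_betw (\<lambda>y. x * y) (UNIV - {0}) (UNIV - {0})"
    using assms by (intro bij_betwI[of _ _ _ "\<lambda>y. y / x"]) auto
  have "(\<Prod>y\<in>UNIV - {0}. x * y) = (\<Prod>y\<in>UNIV - {0::'a}. y)"
    by (rule prod.reindex_bij_betw[OF bij])
  moreover have "(\<Prod>y\<in>UNIV - {0::'a}. y) \<noteq> 0" by simp
  ultimately show ?thesis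
    by (simp add: prod.distrib card_Diff_singleton)
qed

text \<open>The first \<open>CARD('a) - 1\<close> powers already cover all nonzero elements, so by
  counting they are distinct.\<close>

lemma field_generator_pow_eq_iff:
  fixes g :: "'a::{field,finite}"
  assumes g: "field_generator g"
  shows "g ^ i = g ^ j \<longleftrightarrow> [i = j] (mod (CARD('a) - 1))"
proof -
  define N where "N = CARD('a) - 1"
  have "card {0, 1::'a} \<le> CARD('a)" by (intro card_mono) auto
  hence N: "N > 0" by (simp add: N_def)
  have g0: "g \<noteq> 0" using g by (simp add: field_generator_def)
  have red: "g ^ i = g ^ (i mod N)" for i
  proof -
    have "g ^ i = g ^ (i mod N + N * (i div N))" by simp
    also have "\<dots> = g ^ (i mod N)"
      using finite_field_pow_card_minus_1[OF g0] by (simp only: power_add power_mult N_def) simp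
    finally show ?thesis .
  qed
  have "(\<lambda>i. g ^ i) ` {..<N} = UNIV - {0}"
  proof
    show "(\<lambda>i. g ^ i) ` {..<N} \<subseteq> UNIV - {0}" using g0 by auto
    show "UNIV - {0} \<subseteq> (\<lambda>i. g ^ i) ` {..<N}"
    proof
      fix x :: 'a assume "x \<in> UNIV - {0}"
      then obtain i where "x = g ^ i" using g by (auto simp: field_generator_def)
      thus "x \<in> (\<lambda>i. g ^ i) ` {..<N}"
        using red[of i] N by (auto intro: image_eqI[of _ _ "i mod N"])
    qed
  qed
  hence "inj_on (\<lambda>i. g ^ i) {..<N}"
    by (intro eq_card_imp_inj_on) (simp_all add: card_Diff_singleton N_def)
  hence "g ^ (i mod N) = g ^ (j mod N) \<longleftrightarrow> i mod N = j mod N"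
    using N by (auto simp: inj_on_def)
  thus ?thesis using red by (simp add: N_def cong_def)
qed

text \<open>For \<open>x = g^k\<close> the equation reads \<open>n k = i\<close> modulo
  \<open>n M\<close>. It forces \<open>n dvd i\<close>; for \<open>i = n j\<close> the solutions are
  \<open>k = j\<close> modulo \<open>M\<close>, which are \<open>n\<close> classes modulo
  \<open>n M\<close>.\<close>

lemma card_roots_generator_pow:
  fixes g :: "'a::{field,finite}"
  assumes g: "field_generator g" and n: "n dvd CARD('a) - 1"
  shows "card {x. x ^ n = g ^ i} = (if n dvd i then n else 0)"
proof -
  obtain M where M: "CARD('a) - 1 = n * M" using n by blast
  have "card {0, 1::'a} \<le> CARD('a)" by (intro card_mono) auto
  hence nM: "n * M > 0" unfolding M[symmetric] by simp
  have eq_iff: "g ^ a = g ^ b \<longleftrightarrow> a mod (n * M) = b mod (n * M)" for a b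
    using field_generator_pow_eq_iff[OF g] unfolding M cong_def .
  have g0: "g \<noteq> 0" using g by (simp add: field_generator_def)
  have root: "\<exists>k. x = g ^ k \<and> (n * k) mod (n * M) = i mod (n * M)" if "x ^ n = g ^ i" for x
  proof -
    have "x \<noteq> 0" using that g0 nM by (auto simp: power_0_left)
    then obtain k where "x = g ^ k" using g by (auto simp: field_generator_def)
    moreover from this have "g ^ (n * k) = g ^ i"
      using that by (simp add: mult.commute flip: power_mult)
    ultimately show ?thesis unfolding eq_iff by blast
  qed
  show ?thesis
  proof (cases "n dvd i")
    case False
    have "{x. x ^ n = g ^ i} = {}"
      using root False by (metis (mono_tags, lifting) dvd_mod_iff dvd_triv_left empty_Collect_eq)
    thus ?thesis using False by simp
  next
    case True
    then obtain j where i: "i = n * j" by blast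
    have "{x. x ^ n = g ^ i} = (\<lambda>t. g ^ (j + M * t)) ` {..<n}"
    proof (intro equalityI subsetI)
      fix x assume "x \<in> (\<lambda>t. g ^ (j + M * t)) ` {..<n}"
      then obtain t where "x = g ^ (j + M * t)" by blast
      hence "x ^ n = g ^ (n * j + n * M * t)"
        by (simp add: algebra_simps flip: power_mult)
      also have "\<dots> = g ^ i" unfolding eq_iff i by simp
      finally show "x \<in> {x. x ^ n = g ^ i}" by simp
    next
      fix x assume "x \<in> {x. x ^ n = g ^ i}"
      then obtain k where x: "x = g ^ k" and k: "(n * k) mod (n * M) = (n * j) mod (n * M)"
        using root i by blast
      have "k mod M = j mod M" using k nM by (simp add: mult_mod_right[symmetric])
      \<comment> \<open>A multiple of the group order is added to \<open>k\<close> to make the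
        exponent at least \<open>j\<close>, so that the subtraction of naturals is exact.\<close>
      hence kM: "(k + n * M * j) mod M = j mod M" by (metis mod_mult_self2 mult.assoc mult.commute)
      have "j \<le> n * M * j" using nM by simp
      hence "j \<le> k + n * M * j" by linarith
      hence "M dvd (k + n * M * j) - j" using kM mod_eq_dvd_iff_nat by blast
      then obtain s where "k + n * M * j - j = M * s" by blast
      hence s: "k + n * M * j = j + M * s" using \<open>j \<le> k + n * M * j\<close> by linarith
      have "x = g ^ (k + n * M * j)" unfolding x eq_iff by simp
      also have "\<dots> = g ^ (j + M * (s mod n))"
      proof -
        have "s = s mod n + n * (s div n)" by simp
        hence "j + M * s = j + M * (s mod n) + n * M * (s div n)"
          by (metis add.assoc distrib_left mult.assoc mult.left_commute)
        hence "(j + M * s) mod (n * M) = (j + M * (s mod n)) mod (n * M)"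
          by (metis mod_mult_self2)
        thus ?thesis unfolding eq_iff s .
      qed
      finally show "x \<in> (\<lambda>t. g ^ (j + M * t)) ` {..<n}" using nM by auto
    qed
    moreover have "inj_on (\<lambda>t. g ^ (j + M * t)) {..<n}"
    proof (rule inj_onI)
      fix s t assume st: "s \<in> {..<n}" "t \<in> {..<n}" "g ^ (j + M * s) = g ^ (j + M * t)"
      hence "[M * s = M * t] (mod (n * M))"
        unfolding eq_iff by (metis cong_add_lcancel_nat cong_def)
      moreover have "M * s < n * M" "M * t < n * M" using st nM by auto
      ultimately show "s = t" using nM by (simp add: cong_def)
    qed
    ultimately show ?thesis using True by (simp add: card_image)
  qed
qed

section \<open>Counting affine points by cube roots\<close>

definition affine_count :: "'a::{field,finite} \<Rightarrow> nat" where
  "affine_count B = (\<Sum>y\<in>UNIV. card {x. x ^ 3 = y ^ 2 - B})"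

lemma finite_ec_points: "finite (ec_points A (B::'a::{field,finite}))"
proof -
  have "ec_points A B \<subseteq> insert EC_Infinity (range (\<lambda>(x, y). EC_Affine x y))"
    by (auto simp: ec_points_def)
  thus ?thesis by (rule finite_subset) simp
qed

lemma card_ec_points: "card (ec_points 0 B) = affine_count B + 1"
proof -
  let ?S = "SIGMA y:UNIV. {x. x ^ 3 = y ^ 2 - B}"
  have "ec_points 0 B = insert EC_Infinity ((\<lambda>(y, x). EC_Affine x y) ` ?S)"
    by (auto simp: ec_points_def image_iff)
  moreover have "card ((\<lambda>(y, x). EC_Affine x y) ` ?S) = card ?S"
    by (intro card_image) (auto simp: inj_on_def)
  moreover have "card ?S = affine_count B"
    unfolding affine_count_def by (subst card_SigmaI) auto
  ultimately show ?thesis by (auto simp: card_insert_if)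
qed

text \<open>Replacing \<open>y\<close> by \<open>y * h\<close> lets the counts for different twists
  run over the same values \<open>y^2 - B\<close>, so that they can be added termwise.\<close>

lemma affine_count_scale:
  fixes B h :: "'a::{field,finite}"
  assumes "h \<noteq> 0"
  shows "affine_count (B * h ^ 2) = (\<Sum>y\<in>UNIV. card {x. x ^ 3 = (y ^ 2 - B) * h ^ 2})"
proof -
  have bij: "bij (\<lambda>y. y * h)"
    using assms by (intro bij_betwI[of _ _ _ "\<lambda>y. y / h"]) auto
  show ?thesis
    unfolding affine_count_def
    by (subst sum.reindex_bij_betw[OF bij, symmetric]) (simp add: power_mult_distrib left_diff_distrib)
qed

text \<open>For \<open>t \<noteq> 0\<close> exactly one of \<open>t\<close>, \<open>t g^2\<close>,
  \<open>t g^4\<close> is a cube, and it has three cube roots; for \<open>t = 0\<close> each of them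
  has the single root 0.\<close>

lemma affine_count_three_twists:
  fixes B g :: "'a::{field,finite}"
  assumes g: "field_generator g" and q: "3 dvd CARD('a) - 1"
  shows "affine_count B + affine_count (B * g ^ 2) + affine_count (B * g ^ 4) = 3 * CARD('a)"
proof -
  have g0: "g \<noteq> 0" using g by (simp add: field_generator_def)
  have c: "card {x. x ^ 3 = t} + card {x. x ^ 3 = t * g ^ 2} + card {x. x ^ 3 = t * g ^ 4} = 3" for t
  proof (cases "t = 0")
    case True
    have "{x. x ^ 3 = (0::'a)} = {0}" by auto
    with True show ?thesis by simp
  next
    case False
    then obtain i where t: "t = g ^ i" using g by (auto simp: field_generator_def)
    note r = card_roots_generator_pow[OF g q]
    have "(if 3 dvd i then 3 else 0) + (if 3 dvd i + 2 then 3 else 0) + (if 3 dvd i + 4 then 3 else 0) = (3::nat)"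
      by presburger
    thus ?thesis unfolding t power_add[symmetric] r .
  qed
  have "B * g ^ 4 = B * (g ^ 2) ^ 2" by (simp flip: power_mult)
  hence c4: "affine_count (B * g ^ 4) = (\<Sum>y\<in>UNIV. card {x. x ^ 3 = (y ^ 2 - B) * g ^ 4})"
    using affine_count_scale[of "g ^ 2" B] g0 by (simp flip: power_mult)
  have "affine_count B + affine_count (B * g ^ 2) + affine_count (B * g ^ 4) = (\<Sum>y\<in>(UNIV::'a set). 3)"
    unfolding affine_count_scale[OF g0] c4 affine_count_def[of B] sum.distrib[symmetric] c ..
  thus ?thesis by simp
qed

text \<open>Nonzero elements have 0 or 3 cube roots. Modulo 3 only the \<open>y\<close> with
  \<open>y^2 = g^i\<close> count, each once, and there are 2 or 0 of them.\<close>

lemma affine_count_mod_3: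
  fixes g :: "'a::{field,finite}"
  assumes g: "field_generator g" and q: "3 dvd CARD('a) - 1" "2 dvd CARD('a) - 1"
  shows "affine_count (g ^ i) mod 3 = (if even i then 2 else 0)"
proof -
  let ?c = "\<lambda>t::'a. card {x. x ^ 3 = t}"
  have c0: "?c 0 = 1"
  proof -
    have "{x. x ^ 3 = (0::'a)} = {0}" by auto
    thus ?thesis by simp
  qed
  have c3: "3 dvd ?c t" if t: "t \<noteq> 0" for t
  proof -
    obtain j where "t = g ^ j" using t g by (auto simp: field_generator_def)
    thus ?thesis using card_roots_generator_pow[OF g q(1)] by simp
  qed
  have "affine_count (g ^ i) = (\<Sum>y\<in>UNIV. if y ^ 2 = g ^ i then 1 else 0)
      + (\<Sum>y\<in>UNIV. if y ^ 2 = g ^ i then 0 else ?c (y ^ 2 - g ^ i))"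
    unfolding affine_count_def sum.distrib[symmetric] by (intro sum.cong) (auto simp: c0)
  moreover have "(\<Sum>y\<in>UNIV. if y ^ 2 = g ^ i then 1 else 0) = card {y. y ^ 2 = g ^ i}"
    by (simp add: sum.If_cases)
  moreover have "3 dvd (\<Sum>y\<in>UNIV. if y ^ 2 = g ^ i then 0 else ?c (y ^ 2 - g ^ i))"
    by (intro dvd_sum) (auto intro: c3)
  ultimately show ?thesis
    unfolding card_roots_generator_pow[OF g q(2)] by (auto elim!: dvdE) presburger
qed

section \<open>The curves with \<open>A = 0\<close>\<close>

lemma mod_6_odd_cases:
  fixes n :: nat
  assumes "odd n"
  shows "n mod 3 = 1 \<Longrightarrow> n mod 6 = 1" and "n mod 3 = 2 \<Longrightarrow> n mod 6 = 5"
proof -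
  have "(n mod 6) mod 3 = n mod 3" "(n mod 6) mod 2 = n mod 2"
    by (simp_all add: mod_mod_cancel)
  moreover have "n mod 6 < 6" by simp
  hence "n mod 6 = 0 \<or> n mod 6 = 1 \<or> n mod 6 = 2 \<or> n mod 6 = 3 \<or> n mod 6 = 4 \<or> n mod 6 = 5"
    by linarith
  moreover have "n mod 2 = 1" using assms by (simp add: odd_iff_mod_2_eq_one)
  ultimately show "n mod 3 = 1 \<Longrightarrow> n mod 6 = 1" and "n mod 3 = 2 \<Longrightarrow> n mod 6 = 5"
    by (elim disjE; simp)+
qed

lemma CHAR_eq_prime:
  fixes p :: nat
  assumes "prime p" "CARD('a::{field,finite}) = p ^ k"
  shows "CHAR('a) = p"
proof -
  have pr: "prime CHAR('a)"
    by (intro prime_CHAR_semidom finite_imp_CHAR_pos) simp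
  moreover have "CHAR('a) dvd p ^ k"
    using CHAR_dvd_CARD[where ?'a = 'a] assms by simp
  ultimately show ?thesis
    using assms(1) prime_dvd_power primes_dvd_imp_eq by blast
qed

lemma ec_group_iso_Frobenius:
  fixes B :: "'a::{field,finite}"
  assumes "prime p" "CHAR('a) = p"
  shows "ec_group 0 B \<cong> ec_group 0 (B ^ p)"
proof -
  have p: "prime CHAR('a)" and p0: "p > 0" using assms prime_gt_0_nat by auto
  have add: "(x + y) ^ p = x ^ p + y ^ p" for x y :: 'a
    using freshmans_dream[OF p] assms by metis
  have "inj (\<lambda>x::'a. x ^ p)"
  proof (rule injI)
    fix x y :: 'a assume eq: "x ^ p = y ^ p"
    have "x ^ p = ((x - y) + y) ^ p" by simp
    also have "\<dots> = (x - y) ^ p + y ^ p" by (rule add)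
    finally have "(x - y) ^ p = 0" using eq by simp
    thus "x = y" by simp
  qed
  hence "bij (\<lambda>x::'a. x ^ p)" by (simp add: finite_UNIV_inj_surj bij_def)
  from ec_group_iso_ring_automorphism[OF this add, of 0 B] show ?thesis
    using p0 by (simp add: power_mult_distrib power_0_left)
qed

text \<open>Adding \<open>t\<close> times the group order to \<open>j\<close> does not change
  \<open>g^j\<close>. If the result is \<open>i\<close> plus a multiple of 6, the two parameters
  differ by a sixth power, and scaling applies.\<close>

lemma ec_group_iso_generator_pow:
  fixes g :: "'a::{field,finite}"
  assumes g: "field_generator g" and two: "(2::'a) \<noteq> 0"
    and t: "i \<le> j + t * (CARD('a) - 1)" "6 dvd j + t * (CARD('a) - 1) - i"
  shows "ec_group 0 (g ^ i) \<cong> ec_group 0 (g ^ j)"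
proof -
  obtain s where "j + t * (CARD('a) - 1) - i = 6 * s" using t(2) by blast
  hence s: "j + t * (CARD('a) - 1) = i + 6 * s" using t(1) by linarith
  have "g ^ j = g ^ (j + t * (CARD('a) - 1))"
    unfolding field_generator_pow_eq_iff[OF g] by (simp add: cong_def)
  also have "\<dots> = g ^ i * (g ^ s) ^ 6"
    unfolding s by (simp add: power_add mult.commute flip: power_mult)
  finally have j: "g ^ j = g ^ i * (g ^ s) ^ 6" .
  have "g ^ s \<noteq> 0" using g by (simp add: field_generator_def)
  from ec_group_iso_scale[OF two this, of 0 "g ^ i"] show ?thesis unfolding j by simp
qed

lemma affine_count_eq_of_iso:
  assumes "ec_group 0 B \<cong> ec_group 0 B'"
  shows "affine_count B = affine_count B'"
  using iso_same_card[OF assms] by (simp add: card_ec_points)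

section \<open>Fields with q congruent to 2 modulo 3\<close>

text \<open>As \<open>CARD('a) - 1\<close> is 1 modulo 3, a cube root of unity \<open>z\<close>
  satisfies \<open>z = z ^ (CARD('a) - 1) = 1\<close>.\<close>

lemma cube_inj:
  fixes x y :: "'a::{field,finite}"
  assumes "CARD('a) mod 3 = 2" "x ^ 3 = y ^ 3"
  shows "x = y"
proof (cases "y = 0")
  case False
  define z where "z = x / y"
  have z3: "z ^ 3 = 1" using assms False by (simp add: z_def power_divide)
  hence "z \<noteq> 0" by auto
  have "CARD('a) - 1 = 3 * (CARD('a) div 3) + 1"
    using assms(1) mult_div_mod_eq[of 3 "CARD('a)"] by linarith
  hence "z ^ (CARD('a) - 1) = z" by (simp add: power_mult z3)
  hence "z = 1" using finite_field_pow_card_minus_1[OF \<open>z \<noteq> 0\<close>] by simp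
  thus ?thesis using False by (simp add: z_def)
qed (use assms in simp)

lemma affine_count_cube_bij:
  fixes B :: "'a::{field,finite}"
  assumes "CARD('a) mod 3 = 2"
  shows "affine_count B = CARD('a)"
proof -
  have inj: "inj (\<lambda>x::'a. x ^ 3)" using cube_inj[OF assms] by (intro injI)
  hence surj: "surj (\<lambda>x::'a. x ^ 3)" by (simp add: finite_UNIV_inj_surj)
  have "card {x. x ^ 3 = t} = 1" for t :: 'a
  proof -
    obtain z where "t = z ^ 3" using surj by (metis surjD)
    hence "{x. x ^ 3 = t} = {z}" using inj by (auto dest: injD)
    thus ?thesis by simp
  qed
  thus ?thesis by (simp add: affine_count_def)
qed

text \<open>A root \<open>x\<close> would make \<open>(x - 3) / 6\<close> a cube root of unity,
  hence 1. Then \<open>x = 9\<close>, and \<open>81 + 27 = 2^2 * 3^3\<close> would vanish.\<close>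

lemma minus_27_nonsquare:
  fixes x :: "'a::{field,finite}"
  assumes q: "CARD('a) mod 3 = 2" and nz: "(2::'a) \<noteq> 0" "(3::'a) \<noteq> 0"
  shows "x ^ 2 \<noteq> - 27"
proof
  assume x: "x ^ 2 = - 27"
  have "(x - 3) ^ 3 = x * x ^ 2 - 9 * x ^ 2 + 27 * x - 27"
    by (simp add: algebra_simps eval_nat_numeral)
  hence "(x - 3) ^ 3 = 6 ^ 3" unfolding x by simp
  hence "x - 3 = 6" by (rule cube_inj[OF q])
  hence "x = 9" by (simp add: algebra_simps)
  hence "(2::'a) ^ 2 * 3 ^ 3 = 0" using x by (simp add: eq_neg_iff_add_eq_0)
  thus False using nz by (metis mult_eq_0_iff power_not_zero)
qed

text \<open>Since \<open>CARD('a) - 1\<close> is 4 modulo 6, nonzero squares are sixth powers, which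
  settles equal parities. For odd \<open>i\<close> the isogeny multiplies the parameter by the
  nonsquare -27 and so makes the exponent even.\<close>

lemma ec_group_iso_supersingular:
  fixes g :: "'a::{field,finite}"
  assumes q: "CARD('a) mod 3 = 2" "odd CARD('a)" and nz: "(2::'a) \<noteq> 0" "(3::'a) \<noteq> 0"
    and g: "field_generator g"
  shows iso_same_parity: "even (i + j) \<Longrightarrow> ec_group 0 (g ^ i) \<cong> ec_group 0 (g ^ j)"
    and iso_odd_even: "odd i \<Longrightarrow> even j \<Longrightarrow> ec_group 0 (g ^ i) \<cong> ec_group 0 (g ^ j)"
proof -
  define N where "N = CARD('a) - 1"
  define r where "r = CARD('a) div 6"
  have "CARD('a) mod 6 = 5" by (rule mod_6_odd_cases(2)[OF q(2,1)])
  hence r: "N = 6 * r + 4"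
    using mult_div_mod_eq[of 6 "CARD('a)"] unfolding N_def r_def by linarith
  have N2: "2 dvd CARD('a) - 1" unfolding N_def[symmetric] r by simp
  show same: "ec_group 0 (g ^ i) \<cong> ec_group 0 (g ^ j)" if "even (i + j)" for i j
  \<comment> \<open>With \<open>N\<close> equal to 4 modulo 6,
    \<open>j + (4 * i + 2 * j) * N - i\<close> is \<open>15 * i + 9 * j\<close>, that is
    \<open>3 * (i + j)\<close>, modulo 6; this is 0 because \<open>i + j\<close> is even.\<close>
  proof (rule ec_group_iso_generator_pow[OF g nz(1), of _ _ "4 * i + 2 * j"])
    obtain s where s: "i + j = 2 * s" using \<open>even (i + j)\<close> by blast
    have "j + (4 * i + 2 * j) * N = i + (6 * i + 9 * (i + j) + 6 * ((4 * i + 2 * j) * r))"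
      unfolding r by (simp add: algebra_simps)
    hence le: "j + (4 * i + 2 * j) * N = i + 6 * (i + 3 * s + (4 * i + 2 * j) * r)"
      unfolding s by simp
    show "i \<le> j + (4 * i + 2 * j) * (CARD('a) - 1)"
      unfolding N_def[symmetric] le by simp
    show "6 dvd j + (4 * i + 2 * j) * (CARD('a) - 1) - i"
      unfolding N_def[symmetric] le by simp
  qed
  show "ec_group 0 (g ^ i) \<cong> ec_group 0 (g ^ j)" if "odd i" "even j" for i j
  proof -
    have "{x. x ^ 2 = g ^ i} = {}"
      using card_roots_generator_pow[OF g N2, of i] \<open>odd i\<close> by simp
    hence nonsq: "b ^ 2 \<noteq> g ^ i" for b by (metis (mono_tags) empty_Collect_eq)
    have "(- 27 :: 'a) \<noteq> 0"
    proof -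
      have "(3::'a) ^ 3 \<noteq> 0" using nz(2) by (metis power_not_zero)
      thus ?thesis by simp
    qed
    then obtain l where l: "- 27 = g ^ l" by (rule field_generator_powE[OF g])
    have "{x. x ^ 2 = g ^ l} = {}"
      using minus_27_nonsquare[OF q(1) nz] unfolding l[symmetric] by (simp del: power2_eq_iff)
    hence "odd l" using card_roots_generator_pow[OF g N2, of l] by (simp split: if_splits)
    have "ec_group 0 (g ^ i) \<cong> ec_group 0 (- 27 * g ^ i)"
      by (rule ec_group_iso_isog3[OF nz nonsq _ finite_ec_points])
        (simp add: card_ec_points affine_count_cube_bij[OF q(1)])
    also have "- 27 * g ^ i = g ^ (l + i)" unfolding l by (simp add: power_add)
    also have "ec_group 0 (g ^ (l + i)) \<cong> ec_group 0 (g ^ j)"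
      using that \<open>odd l\<close> by (intro same) simp
    finally show ?thesis .
  qed
qed

section \<open>Fields with q congruent to 1 modulo 6\<close>

text \<open>Negation modulo 6, written as multiplication by 5, has the orbits {0}, {2, 4}, {3}, {1,
  5}; within each parity \<open>c\<close> separates them.\<close>

lemma mod_6_class_of_count_eq:
  fixes c :: "nat \<Rightarrow> nat"
  assumes "a < 6" "b < 6" "even a \<longleftrightarrow> even b" "c a = c b"
    and "c 4 = c 2" "c 5 = c 1" "c 0 \<noteq> c 2" "c 1 \<noteq> c 3"
  shows "a = b \<or> (5 * a) mod 6 = b"
proof -
  have "a = 0 \<or> a = 1 \<or> a = 2 \<or> a = 3 \<or> a = 4 \<or> a = 5"
    "b = 0 \<or> b = 1 \<or> b = 2 \<or> b = 3 \<or> b = 4 \<or> b = 5"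
    using assms(1,2) by linarith+
  thus ?thesis using assms(3-) by (elim disjE) simp_all
qed

lemma ec_group_iso_of_affine_count_eq:
  fixes g :: "'a::{field,finite}" and p :: nat
  assumes q: "6 dvd CARD('a) - 1" and two: "(2::'a) \<noteq> 0"
    and p: "prime p" "CHAR('a) = p" "p mod 6 = 5"
    and g: "field_generator g" and eq: "affine_count (g ^ i) = affine_count (g ^ j)"
  shows "ec_group 0 (g ^ i) \<cong> ec_group 0 (g ^ j)"
proof -
  define N where "N = CARD('a) - 1"
  have "card {0, 1::'a} \<le> CARD('a)" by (intro card_mono) auto
  hence N0: "N > 0" by (simp add: N_def)
  have q3: "3 dvd CARD('a) - 1" "2 dvd CARD('a) - 1"
    by (rule dvd_trans[OF _ q], simp)+
  have iso: "ec_group 0 (g ^ i) \<cong> ec_group 0 (g ^ j)" if "i mod 6 = j mod 6" for i j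
  \<comment> \<open>The order \<open>N\<close> is divisible by 6, so adding \<open>i * N\<close>
    preserves the class modulo 6 while making the exponent at least \<open>i\<close>.\<close>
  proof (rule ec_group_iso_generator_pow[OF g two, of _ _ i])
    obtain r where r: "N = 6 * r" using q unfolding N_def by blast
    have "i \<le> i * N" using N0 by simp
    thus le: "i \<le> j + i * (CARD('a) - 1)" unfolding N_def by linarith
    have "j + i * N = j + 6 * (i * r)" unfolding r by simp
    hence "(j + i * N) mod 6 = j mod 6" by (simp only: mod_mult_self2)
    hence "(j + i * N) mod 6 = i mod 6" using that by (rule trans[OF _ sym])
    thus "6 dvd j + i * (CARD('a) - 1) - i"
      using le mod_eq_dvd_iff_nat unfolding N_def by blast
  qed
  have frob: "ec_group 0 (g ^ i) \<cong> ec_group 0 (g ^ j)" if "(5 * i) mod 6 = j mod 6" for i j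
  proof -
    have "ec_group 0 (g ^ i) \<cong> ec_group 0 (g ^ (i * p))"
      using ec_group_iso_Frobenius[OF p(1,2), of "g ^ i"] by (simp add: power_mult)
    also have "(i * p) mod 6 = j mod 6"
      using that p(3) by (metis mod_mult_right_eq mult.commute)
    hence "ec_group 0 (g ^ (i * p)) \<cong> ec_group 0 (g ^ j)" by (rule iso)
    finally show ?thesis .
  qed
  define c where "c = (\<lambda>i. affine_count (g ^ i))"
  have c_mod: "c i = c (i mod 6)" for i
    unfolding c_def by (intro affine_count_eq_of_iso iso) simp
  have c5: "c 5 = c 1" and c4: "c 4 = c 2"
    unfolding c_def by (intro affine_count_eq_of_iso frob; simp)+
  have sum: "c i + c (i + 2) + c (i + 4) = 3 * CARD('a)" for i
    using affine_count_three_twists[OF g q3(1), of "g ^ i"] unfolding c_def power_add .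
  have s0: "c 0 + 2 * c 2 = 3 * CARD('a)" using sum[of 0] c4 unfolding add_0_left by linarith
  have s1: "c 3 + 2 * c 1 = 3 * CARD('a)"
  proof -
    have "1 + 2 = (3::nat)" "1 + 4 = (5::nat)" by simp_all
    hence "c 1 + c 3 + c 5 = 3 * CARD('a)" using sum[of 1] by (simp only:)
    thus ?thesis using c5 by linarith
  qed
  have m3: "c i mod 3 = (if even i then 2 else 0)" for i
    unfolding c_def by (rule affine_count_mod_3[OF g q3])
  have q1: "CARD('a) mod 3 = 1"
  proof -
    obtain r where "CARD('a) - 1 = 3 * r" using q3(1) by blast
    hence "CARD('a) = 3 * r + 1" using N0 unfolding N_def by linarith
    thus ?thesis by simp
  qed
  have ne02: "c 0 \<noteq> c 2"
  proof
    assume "c 0 = c 2"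
    hence "c 0 = CARD('a)" using s0 by simp
    thus False using m3[of 0] q1 by simp
  qed
  have ne13: "c 1 \<noteq> c 3"
  proof
    assume "c 1 = c 3"
    hence "c 1 = CARD('a)" using s1 by simp
    thus False using m3[of 1] q1 by simp
  qed
  \<comment> \<open>The common count modulo 3 reveals the parity of the exponent.\<close>
  have "even i \<longleftrightarrow> even j" using m3[of i] m3[of j] eq by (simp add: c_def split: if_splits)
  hence parity: "even (i mod 6) \<longleftrightarrow> even (j mod 6)"
    by (simp add: dvd_mod_iff)
  have "c i = c j" using eq by (simp add: c_def)
  hence cc: "c (i mod 6) = c (j mod 6)"
    by (rule trans[OF trans[OF c_mod[of i, symmetric]] c_mod[of j]])
  have "i mod 6 < 6" "j mod 6 < 6" by simp_all
  from mod_6_class_of_count_eq[where c = c, OF this parity cc c4 c5 ne02 ne13]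
  have "i mod 6 = j mod 6 \<or> (5 * i) mod 6 = j mod 6"
    by (simp only: mod_mult_right_eq)
  thus ?thesis using iso frob by blast
qed

section \<open>Reduction to powers of a generator and to the parity of \<open>k\<close>\<close>

theorem theorem4p8:
  fixes p k q :: nat
    and A1 B1 A2 B2 :: "'a::{field, finite}"
  assumes "prime p" and "p > 3" and "p mod 3 = 2"
    and "k \<ge> 1" and "q = p ^ k" and "CARD('a) = q"
    and "elliptic_curve A1 B1" and "elliptic_curve A2 B2"
    and "j_invariant A1 B1 = 0" and "j_invariant A2 B2 = 0"
  shows "card (carrier (ec_group A1 B1)) = card (carrier (ec_group A2 B2))
         \<longleftrightarrow> ec_group A1 B1 \<cong> ec_group A2 B2"
proof
  assume "ec_group A1 B1 \<cong> ec_group A2 B2"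
  thus "card (carrier (ec_group A1 B1)) = card (carrier (ec_group A2 B2))"
    by (rule iso_same_card)
next
  assume card: "card (carrier (ec_group A1 B1)) = card (carrier (ec_group A2 B2))"
  have CHAR: "CHAR('a) = p"
    using assms by (intro CHAR_eq_prime) auto
  have "\<not> p dvd 2" "\<not> p dvd 3" using \<open>p > 3\<close> by (auto dest: dvd_imp_le)
  hence two: "(2::'a) \<noteq> 0" and three: "(3::'a) \<noteq> 0"
    using of_nat_eq_0_iff_char_dvd[where ?'a = 'a, of 2]
      of_nat_eq_0_iff_char_dvd[where ?'a = 'a, of 3] CHAR by simp_all
  \<comment> \<open>The constant in the numerator of \<open>j\<close> has only the prime factors 2
    and 3, so \<open>j = 0\<close> forces \<open>A = 0\<close>.\<close>
  have "(1728::'a) * 4 = 2 ^ 8 * 3 ^ 3" by simp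
  hence c: "(1728::'a) * 4 \<noteq> 0" using two three by (metis mult_eq_0_iff power_not_zero)
  have A0: "A = 0 \<and> B \<noteq> 0" if "elliptic_curve A B" "j_invariant A B = 0" for A B :: 'a
    using that c by (auto simp: elliptic_curve_def j_invariant_def)
  have A: "A1 = 0" "A2 = 0" and B: "B1 \<noteq> 0" "B2 \<noteq> 0" using A0 assms by auto
  obtain g :: 'a where g: "field_generator g" using ex_field_generator by blast
  obtain i j where ij: "B1 = g ^ i" "B2 = g ^ j"
    using field_generator_powE[OF g B(1)] field_generator_powE[OF g B(2)] by metis
  have "odd p" using \<open>prime p\<close> \<open>p > 3\<close> by (intro prime_odd_nat) auto
  hence odd_q: "odd CARD('a)" using assms by simp
  show "ec_group A1 B1 \<cong> ec_group A2 B2"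
  proof (cases "even k")
    case True
    then obtain m where "k = 2 * m" by blast
    hence "q = (p ^ 2) ^ m" using assms by (simp add: power_mult)
    moreover have "[p ^ 2 = 2 ^ 2] (mod 3)"
      using assms(3) by (intro cong_pow) (simp add: cong_def)
    hence "[p ^ 2 = 1] (mod 3)" by (simp add: cong_def)
    ultimately have "[q = 1] (mod 3)" using cong_pow[of "p ^ 2" 1 3 m] by simp
    hence "q mod 3 = 1" by (simp add: cong_def)
    hence "CARD('a) mod 6 = 1" using odd_q assms(6) by (intro mod_6_odd_cases) simp_all
    hence "6 dvd CARD('a) - 1" using mod_eq_dvd_iff_nat[of 1 "CARD('a)" 6] by simp
    moreover have "p mod 6 = 5" using \<open>odd p\<close> assms(3) by (intro mod_6_odd_cases)
    moreover have "affine_count (g ^ i) = affine_count (g ^ j)"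
      using card by (simp add: A ij card_ec_points)
    ultimately show ?thesis
      unfolding A ij using two assms(1) CHAR g by (intro ec_group_iso_of_affine_count_eq) auto
  next
    case False
    then obtain m where "k = 2 * m + 1" by (metis oddE)
    hence "q = (p ^ 2) ^ m * p" using assms by (simp add: power_mult)
    moreover have "[p ^ 2 = 2 ^ 2] (mod 3)"
      using assms(3) by (intro cong_pow) (simp add: cong_def)
    hence "[p ^ 2 = 1] (mod 3)" by (simp add: cong_def)
    hence "[(p ^ 2) ^ m * p = 1 * 2] (mod 3)"
      using cong_pow[of "p ^ 2" 1 3 m] assms(3) by (intro cong_mult) (simp_all add: cong_def)
    ultimately have q: "CARD('a) mod 3 = 2" using assms(6) by (simp add: cong_def)
    note same = iso_same_parity[OF q odd_q two three g]
      and diff = iso_odd_even[OF q odd_q two three g]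
    show ?thesis
    proof (cases "even (i + j)")
      case True
      thus ?thesis unfolding A ij by (rule same)
    next
      case False
      \<comment> \<open>The isogeny argument starts from the odd exponent; the other order is
        obtained by inverting the isomorphism.\<close>
      hence "odd i \<and> even j \<or> odd j \<and> even i" by auto
      thus ?thesis
        unfolding A ij using diff ec_group_iso_sym[OF two] by blast
    qed
  qed
qed

end
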